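(* Let $N\ge 3$. Then $O\!N\!C_N\subseteq\mathfrak{A}_N$, and for all $x,y\in O\!N\!C_N$ one has $x\le_{\mathbf 3}y$ if and only if $x\le_{\mathbf 2}y$; i.e. the poset $(O\!N\!C_N,\le_{\mathbf 3})$ is an induced subposet of $(N\!C_N,\le_{\mathbf 2})$.
   Context: $\mathfrak{S}_N$ is the symmetric group on $[N]$, $\mathfrak{A}_N$ the alternating group; products are composed right to left. For $x\in\mathfrak{S}_N$, $\ell_{\mathbf 2}(x)$ is the minimal number of transpositions with product $x$ and $x\le_{\mathbf 2}y$ iff $\ell_{\mathbf 2}(y)=\ell_{\mathbf 2}(x)+\ell_{\mathbf 2}(x^{-1}y)$. For $x\in\mathfrak{A}_N$, $\ell_{\mathbf 3}(x)$ is the minimal number of $3$-cycles with product $x$ and $x\le_{\mathbf 3}y$ iff $\ell_{\mathbf 3}(y)=\ell_{\mathbf 3}(x)+\ell_{\mathbf 3}(x^{-1}y)$. Let $c=(1\;2\;\ldots\;N)$. $N\!C_N=\{x\in\mathfrak S_N: x\le_{\mathbf 2}c\}$ (the noncrossing partitions; each cycle of such $x$, including fixed points, can be written as an increasing cycle $(u_1<u_2<\cdots<u_q)$). $O\!N\!C_N$ is the set of $x\in N\!C_N$ all of whose cycles $(u_1<\cdots<u_q)$ satisfy: $q$ is odd and $u_{j+1}-u_j$ is odd for all $j\in[q-1]$. *)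

theory Defs
  imports "HOL-Algebra.Sym_Groups"
begin

text \<open>Permutations of \<open>[N]\<close> are functions \<open>nat \<Rightarrow> nat\<close> that permute \<open>{1..N}\<close>, as in
  \<^const>\<open>sym_group\<close> and \<^const>\<open>alt_group\<close>; products are composed right to left.\<close>

definition transpositions :: "nat \<Rightarrow> (nat \<Rightarrow> nat) set" where
  "transpositions N = {transpose a b | a b. a \<in> {1..N} \<and> b \<in> {1..N} \<and> a \<noteq> b}"

text \<open>Meaningful only for \<open>x\<close> in the group generated by \<open>T\<close>; the value of
  \<^const>\<open>Least\<close> is unspecified otherwise.\<close>

definition gen_length :: "(nat \<Rightarrow> nat) set \<Rightarrow> (nat \<Rightarrow> nat) \<Rightarrow> nat" where
  "gen_length T x = (LEAST k. \<exists>ts. length ts = k \<and> set ts \<subseteq> T \<and> foldr (\<circ>) ts id = x)"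

definition len2 :: "nat \<Rightarrow> (nat \<Rightarrow> nat) \<Rightarrow> nat" where
  "len2 N = gen_length (transpositions N)"

definition len3 :: "nat \<Rightarrow> (nat \<Rightarrow> nat) \<Rightarrow> nat" where
  "len3 N = gen_length (three_cycles N)"

definition le2 :: "nat \<Rightarrow> (nat \<Rightarrow> nat) \<Rightarrow> (nat \<Rightarrow> nat) \<Rightarrow> bool" where
  "le2 N x y \<longleftrightarrow> len2 N y = len2 N x + len2 N (inv' x \<circ> y)"

definition le3 :: "nat \<Rightarrow> (nat \<Rightarrow> nat) \<Rightarrow> (nat \<Rightarrow> nat) \<Rightarrow> bool" where
  "le3 N x y \<longleftrightarrow> len3 N y = len3 N x + len3 N (inv' x \<circ> y)"

definition long_cycle :: "nat \<Rightarrow> nat \<Rightarrow> nat" where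
  "long_cycle N = cycle_of_list [1..<Suc N]"

definition NC :: "nat \<Rightarrow> (nat \<Rightarrow> nat) set" where
  "NC N = {x \<in> carrier (sym_group N). le2 N x (long_cycle N)}"

text \<open>\<open>us = [u\<^sub>1, \<dots>, u\<^sub>q]\<close> with \<open>u\<^sub>1 < \<dots> < u\<^sub>q\<close> is a cycle of \<open>x\<close>: the equation with
  \<^const>\<open>rotate1\<close> says that \<open>x\<close> sends each \<open>u\<^sub>j\<close> to \<open>u\<^sub>j\<^sub>+\<^sub>1\<close> and \<open>u\<^sub>q\<close> to \<open>u\<^sub>1\<close>.
  Fixed points are the case \<open>q = 1\<close>.\<close>

definition increasing_cycle_of :: "nat \<Rightarrow> (nat \<Rightarrow> nat) \<Rightarrow> nat list \<Rightarrow> bool" where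
  "increasing_cycle_of N x us \<longleftrightarrow>
     us \<noteq> [] \<and> set us \<subseteq> {1..N} \<and> sorted_wrt (<) us \<and> map x us = rotate1 us"

text \<open>Every cycle of a member of \<^term>\<open>NC N\<close> can be written increasingly, so quantifying over
  the increasing cycles covers all cycles. List indices start at 0.\<close>

definition ONC :: "nat \<Rightarrow> (nat \<Rightarrow> nat) set" where
  "ONC N = {x \<in> NC N. \<forall>us. increasing_cycle_of N x us \<longrightarrow>
     odd (length us) \<and> (\<forall>j < length us - 1. odd (us ! Suc j - us ! j))}"

definition rel_on :: "'a set \<Rightarrow> ('a \<Rightarrow> 'a \<Rightarrow> bool) \<Rightarrow> 'a rel" where
  "rel_on A R = {(x, y). x \<in> A \<and> y \<in> A \<and> R x y}"

definition induced_subposet ::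
  "'a set \<Rightarrow> ('a \<Rightarrow> 'a \<Rightarrow> bool) \<Rightarrow> 'a set \<Rightarrow> ('a \<Rightarrow> 'a \<Rightarrow> bool) \<Rightarrow> bool" where
  "induced_subposet A R B S \<longleftrightarrow>
     partial_order_on A (rel_on A R) \<and> partial_order_on B (rel_on B S) \<and>
     A \<subseteq> B \<and> rel_on A R = rel_on B S \<inter> (A \<times> A)"

end

theory Submission
  imports Defs "HOL-Combinatorics.Orbits"
begin

text \<open>If \<open>x\<close> lies below \<open>y\<close> for transpositions, then \<open>x\<close> arises from \<open>y\<close> by splitting cycles, so
  increasing cycles stay increasing and orbits are refined. Among permutations with increasing
  cycles, the members of \<open>ONC\<close> are those that change the parity of \<open>u\<close> exactly when \<open>u < x u\<close>.
  This local form passes from \<open>x \<le> y\<close> to \<open>x\<^sup>-\<^sup>1 y\<close>, and it lets one strip off 3-cycles each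
  of which lowers the transposition length by two. Hence the 3-cycle lengths of \<open>x\<close>, \<open>y\<close> and
  \<open>x\<^sup>-\<^sup>1 y\<close> are half their transposition lengths; conversely the transposition length is at most
  twice the 3-cycle length, and the triangle inequality gives the other implication.

  Transposition length is controlled through the number of invariant sets, which is 2 to the
  number of cycles: merging two cycles halves it.\<close>

section \<open>Invariant sets and orbits\<close>

text \<open>For \<open>p\<close> permuting a finite \<open>S\<close> these are the unions of cycles
  of \<open>p\<close> inside \<open>S\<close>, fixed points counting as cycles. Counting them stands
  in for counting cycles.\<close>

definition invariant_sets :: "'a set \<Rightarrow> ('a \<Rightarrow> 'a) \<Rightarrow> 'a set set" where
  "invariant_sets S p = {A. A \<subseteq> S \<and> (\<forall>u. p u \<in> A \<longleftrightarrow> u \<in> A)}"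

lemma finite_invariant_sets: "finite S \<Longrightarrow> finite (invariant_sets S p)"
  by (rule finite_subset[of _ "Pow S"]) (auto simp: invariant_sets_def)

lemma invariant_sets_id: "invariant_sets S id = Pow S"
  by (auto simp: invariant_sets_def)

lemma card_invariant_sets_conj:
  assumes "p permutes S" "q permutes S"
  shows "card (invariant_sets S (inv' q \<circ> p \<circ> q)) = card (invariant_sets S p)"
proof -
  have qi: "q (inv' q v) = v" "inv' q (q v) = v" for v
    using permutes_inverses[OF assms(2)] by auto
  have iq: "inv' q permutes S" using assms(2) by (rule permutes_inv)
  have "bij_betw (\<lambda>A. q -` A) (invariant_sets S p) (invariant_sets S (inv' q \<circ> p \<circ> q))"
  proof (rule bij_betw_byWitness[where f' = "\<lambda>A. inv' q -` A"])
    show "(\<lambda>A. q -` A) ` invariant_sets S p \<subseteq> invariant_sets S (inv' q \<circ> p \<circ> q)"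
      using permutes_in_image[OF assms(2)] by (auto simp: invariant_sets_def qi)
    show "(\<lambda>A. inv' q -` A) ` invariant_sets S (inv' q \<circ> p \<circ> q) \<subseteq> invariant_sets S p"
    proof clarify
      fix A assume A: "A \<in> invariant_sets S (inv' q \<circ> p \<circ> q)"
      have "inv' q (p u) \<in> A \<longleftrightarrow> inv' q u \<in> A" for u
      proof -
        have "(inv' q \<circ> p \<circ> q) (inv' q u) \<in> A \<longleftrightarrow> inv' q u \<in> A"
          using A unfolding invariant_sets_def by blast
        then show ?thesis by (simp add: qi)
      qed
      moreover have "inv' q -` A \<subseteq> S"
        using A permutes_in_image[OF iq] by (auto simp: invariant_sets_def)
      ultimately show "inv' q -` A \<in> invariant_sets S p"
        by (simp add: invariant_sets_def)
    qed
  qed (auto simp: qi)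
  then show ?thesis using bij_betw_same_card by metis
qed

section \<open>Orbits under multiplication by a transposition\<close>

lemma permutes_self_in_orbit: "finite S \<Longrightarrow> p permutes S \<Longrightarrow> u \<in> orbit p u"
  by (meson permutation_permutes permutation_self_in_orbit)

lemma orbit_sym: "finite S \<Longrightarrow> p permutes S \<Longrightarrow> v \<in> orbit p u \<Longrightarrow> u \<in> orbit p v"
  by (meson permutes_self_in_orbit orbit_swap)

lemma orbit_subset_closed:
  assumes "a \<in> A" "\<And>u. u \<in> A \<Longrightarrow> p u \<in> A"
  shows "orbit p a \<subseteq> A"
proof
  fix v assume "v \<in> orbit p a"
  then show "v \<in> A" by induct (use assms in auto)
qed

lemma orbit_step_iff: "finite S \<Longrightarrow> p permutes S \<Longrightarrow> p u \<in> orbit p a \<longleftrightarrow> u \<in> orbit p a"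
  by (metis orbit.base orbit.step orbit_sym orbit_trans)

lemma invariant_sets_orbit_mem:
  assumes "A \<in> invariant_sets S p" "v \<in> orbit p u"
  shows "v \<in> A \<longleftrightarrow> u \<in> A"
  using assms(2) by induct (use assms(1) in \<open>auto simp: invariant_sets_def\<close>)

lemma invariant_sets_comp_transpose:
  assumes "A \<in> invariant_sets S p" "a \<in> A \<longleftrightarrow> b \<in> A"
  shows "A \<in> invariant_sets S (p \<circ> transpose a b)"
  using assms by (auto simp: invariant_sets_def transpose_def)

lemma comp_transpose_cancel: "p \<circ> transpose a b \<circ> transpose a b = p"
  by (simp add: comp_assoc)

text \<open>The new permutation sends \<open>a\<close> to \<open>p b\<close> and then follows
  \<open>p\<close> along the old cycle of \<open>b\<close>, which misses \<open>a\<close>, until it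
  arrives at \<open>b\<close>.\<close>

lemma mem_orbit_comp_transpose:
  assumes fin: "finite S" and p: "p permutes S" and b: "b \<notin> orbit p a"
  shows "b \<in> orbit (p \<circ> transpose a b) a"
proof -
  define q where "q = p \<circ> transpose a b"
  have qa: "q a = p b" by (simp add: q_def)
  have q: "q v = p v" if "v \<noteq> a" "v \<noteq> b" for v using that by (simp add: q_def transpose_def)
  have a: "a \<notin> orbit p b" using b orbit_sym[OF fin p] by blast
  have "v \<in> orbit q a" if "v \<in> orbit p b" for v
    using that
  proof induct
    case base
    show ?case using orbit.base[of q a] by (simp add: qa)
  next
    case (step v)
    show ?case
    proof (cases "v = b")
      case True
      then show ?thesis using orbit.base[of q a] by (simp add: qa)
    next
      case False
      moreover have "v \<noteq> a" using step a by blast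
      ultimately show ?thesis using orbit.step[OF step(2)] by (simp add: q)
    qed
  qed
  then have "b \<in> orbit q a" using permutes_self_in_orbit[OF fin p] by blast
  then show ?thesis by (simp add: q_def)
qed

text \<open>After the merge \<open>a\<close> and \<open>b\<close> share a cycle, so no invariant set
  separates them. Sets not separating them are invariant under the transposition, and since that is
  an involution one argument serves both inclusions.\<close>

lemma invariant_sets_merge:
  assumes fin: "finite S" and p: "p permutes S" and b: "b \<notin> orbit p a"
  shows "invariant_sets S (p \<circ> transpose a b) = {A \<in> invariant_sets S p. a \<in> A \<longleftrightarrow> b \<in> A}"
    (is "?L = ?R")
proof
  show "?L \<subseteq> ?R"
  proof
    fix A assume A: "A \<in> ?L"
    have ab: "b \<in> A \<longleftrightarrow> a \<in> A"
      using invariant_sets_orbit_mem[OF A mem_orbit_comp_transpose[OF assms]] .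
    then have "A \<in> invariant_sets S (p \<circ> transpose a b \<circ> transpose a b)"
      using invariant_sets_comp_transpose[OF A] by blast
    then show "A \<in> ?R" using ab by (simp add: comp_transpose_cancel)
  qed
  show "?R \<subseteq> ?L"
  proof
    fix A assume "A \<in> ?R"
    then show "A \<in> ?L" by (simp add: invariant_sets_comp_transpose)
  qed
qed

text \<open>Taking the symmetric difference with the orbit of \<open>a\<close> exchanges the invariant sets that
  separate \<open>a\<close> from \<open>b\<close> with those that do not.\<close>

lemma card_invariant_sets_merge:
  assumes fin: "finite S" and p: "p permutes S" and a: "a \<in> S" and b: "b \<notin> orbit p a"
  shows "card (invariant_sets S p) = 2 * card (invariant_sets S (p \<circ> transpose a b))"
proof -
  let ?O = "orbit p a"
  define agree where "agree = {A \<in> invariant_sets S p. a \<in> A \<longleftrightarrow> b \<in> A}"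
  define differ where "differ = {A \<in> invariant_sets S p. \<not> (a \<in> A \<longleftrightarrow> b \<in> A)}"
  define f where "f = (\<lambda>A. (A - ?O) \<union> (?O - A))"
  have O: "?O \<subseteq> S" using permutes_orbit_subset[OF p a] .
  have aO: "a \<in> ?O" using permutes_self_in_orbit[OF fin p] .
  have inv: "f A \<in> invariant_sets S p" if "A \<in> invariant_sets S p" for A
    using that O orbit_step_iff[OF fin p, of _ a] by (auto simp: invariant_sets_def f_def)
  have ff: "f (f A) = A" for A by (auto simp: f_def)
  have "bij_betw f agree differ"
  proof (rule bij_betw_byWitness[where f' = f])
    show "f ` agree \<subseteq> differ" "f ` differ \<subseteq> agree"
      using inv aO b unfolding agree_def differ_def by (auto simp: f_def)
  qed (auto simp: ff)
  then have eq: "card agree = card differ" by (rule bij_betw_same_card)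
  have "invariant_sets S p = agree \<union> differ" "agree \<inter> differ = {}"
    by (auto simp: agree_def differ_def)
  moreover have "finite agree" "finite differ"
    using finite_invariant_sets[OF fin] by (auto simp: agree_def differ_def)
  ultimately have "card (invariant_sets S p) = card agree + card differ"
    by (simp add: card_Un_disjoint)
  then show ?thesis using eq invariant_sets_merge[OF fin p b] by (simp add: agree_def)
qed

text \<open>If \<open>a\<close> and \<open>b\<close> share a cycle, every invariant set survives;
  otherwise the merge formula gives equality.\<close>

lemma card_invariant_sets_comp_transpose_le:
  assumes fin: "finite S" and p: "p permutes S" and a: "a \<in> S"
  shows "card (invariant_sets S p) \<le> 2 * card (invariant_sets S (p \<circ> transpose a b))"
proof (cases "b \<in> orbit p a")
  case True
  have "invariant_sets S p \<subseteq> invariant_sets S (p \<circ> transpose a b)"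
  proof
    fix A assume A: "A \<in> invariant_sets S p"
    show "A \<in> invariant_sets S (p \<circ> transpose a b)"
      using invariant_sets_comp_transpose[OF A] invariant_sets_orbit_mem[OF A True] by simp
  qed
  then have "card (invariant_sets S p) \<le> card (invariant_sets S (p \<circ> transpose a b))"
    using finite_invariant_sets[OF fin] card_mono by blast
  then show ?thesis by simp
qed (use card_invariant_sets_merge[OF assms] in simp)

section \<open>Word length\<close>

definition word_prod :: "('a \<Rightarrow> 'a) list \<Rightarrow> 'a \<Rightarrow> 'a" where
  "word_prod ts = foldr (\<circ>) ts id"

lemma word_prod_Nil [simp]: "word_prod [] = id"
  by (simp add: word_prod_def)

lemma word_prod_Cons [simp]: "word_prod (t # ts) = t \<circ> word_prod ts"
  by (simp add: word_prod_def)

lemma word_prod_append [simp]: "word_prod (xs @ ys) = word_prod xs \<circ> word_prod ys"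
proof (induct xs)
  case (Cons t xs)
  show ?case using arg_cong[OF Cons, of "(\<circ>) t"] by (simp add: comp_assoc)
qed simp

lemma gen_length_le: "set ts \<subseteq> T \<Longrightarrow> word_prod ts = x \<Longrightarrow> gen_length T x \<le> length ts"
  unfolding gen_length_def word_prod_def by (rule Least_le) blast

text \<open>A word for \<open>x\<close> must be supplied: without one the value of
  \<open>Least\<close> is unspecified.\<close>

lemma gen_length_word:
  assumes "set ts \<subseteq> T" "word_prod ts = x"
  obtains us where "length us = gen_length T x" "set us \<subseteq> T" "word_prod us = x"
proof -
  have "\<exists>k us. length us = k \<and> set us \<subseteq> T \<and> word_prod us = x"
    using assms by blast
  then have "\<exists>us. length us = gen_length T x \<and> set us \<subseteq> T \<and> word_prod us = x"
    unfolding gen_length_def word_prod_def by (rule LeastI_ex)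
  then show thesis using that by blast
qed

lemma transposition_permutes: "t \<in> transpositions N \<Longrightarrow> t permutes {1..N}"
  by (auto simp: transpositions_def intro: permutes_swap_id)

lemma word_prod_transpositions_permutes:
  "set ts \<subseteq> transpositions N \<Longrightarrow> word_prod ts permutes {1..N}"
proof (induct ts)
  case (Cons t ts)
  show "word_prod (t # ts) permutes {1..N}"
    using Cons transposition_permutes permutes_compose[of "word_prod ts" "{1..N}" t] by simp
qed (simp add: permutes_id)

text \<open>The identity has \<open>2 ^ N\<close> invariant sets and each further letter at most
  halves their number. Letters are appended on the right, where the transposition lemmas
  apply.\<close>

lemma word_prod_transpositions_lower:
  "set ts \<subseteq> transpositions N \<Longrightarrow>
    2 ^ N \<le> card (invariant_sets {1..N} (word_prod ts)) * 2 ^ length ts"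
proof (induct ts rule: rev_induct)
  case Nil
  show "2 ^ N \<le> card (invariant_sets {1..N} (word_prod [])) * 2 ^ length ([] :: (nat \<Rightarrow> nat) list)"
    by (simp add: invariant_sets_id card_Pow)
next
  case (snoc t ts)
  let ?p = "word_prod ts"
  obtain a b where t: "t = transpose a b" "a \<in> {1..N}"
    using snoc(2) by (auto simp: transpositions_def)
  have "?p permutes {1..N}" using snoc(2) word_prod_transpositions_permutes by simp
  then have "card (invariant_sets {1..N} ?p) \<le> 2 * card (invariant_sets {1..N} (?p \<circ> t))"
    using card_invariant_sets_comp_transpose_le[of "{1..N}" ?p a b] t by simp
  then have "card (invariant_sets {1..N} ?p) * 2 ^ length ts
      \<le> 2 * card (invariant_sets {1..N} (?p \<circ> t)) * 2 ^ length ts"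
    by (rule mult_le_mono1)
  moreover have "2 ^ N \<le> card (invariant_sets {1..N} ?p) * 2 ^ length ts" using snoc by simp
  ultimately have "2 ^ N \<le> 2 * card (invariant_sets {1..N} (word_prod ts \<circ> t)) * 2 ^ length ts"
    by (rule order_trans[rotated])
  then show "2 ^ N \<le> card (invariant_sets {1..N} (word_prod (ts @ [t]))) * 2 ^ length (ts @ [t])"
    by (simp add: mult_ac)
qed

text \<open>Moved points are turned into fixed points one at a time. Each such step doubles the
  number of invariant sets, so the bound of the previous lemma is attained.\<close>

lemma exists_short_transposition_word:
  assumes "x permutes {1..N}"
  shows "\<exists>ts. set ts \<subseteq> transpositions N \<and> word_prod ts = x \<and>
    card (invariant_sets {1..N} x) * 2 ^ length ts = 2 ^ N"
  using assms
proof (induct "card {u. x u \<noteq> u}" arbitrary: x rule: less_induct)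
  case less
  show ?case
  proof (cases "x = id")
    case True
    then show ?thesis by (intro exI[of _ "[]"]) (simp add: invariant_sets_id card_Pow)
  next
    case False
    then obtain a where a: "x a \<noteq> a" by (auto simp: fun_eq_iff)
    \<comment> \<open>With the preimage as partner, \<open>y a = x b = a\<close>, so
      \<open>a\<close> becomes a fixed point.\<close>
    define b where "b = inv' x a"
    have xb: "x b = a" using permutes_inverses[OF less.prems] by (simp add: b_def)
    have aN: "a \<in> {1..N}" using a less.prems by (meson permutes_not_in)
    then have bN: "b \<in> {1..N}" using permutes_in_image[OF less.prems] xb by metis
    have ab: "a \<noteq> b" using a xb by auto
    let ?t = "transpose a b"
    have t: "?t \<in> transpositions N" using aN bN ab by (auto simp: transpositions_def)
    define y where "y = x \<circ> ?t"
    have y: "y permutes {1..N}"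
      unfolding y_def using less.prems t transposition_permutes permutes_compose by blast
    have ya: "y a = a" by (simp add: y_def xb)
    have "{u. y u \<noteq> u} \<subseteq> {u. x u \<noteq> u} - {a}"
      using ya xb ab by (auto simp: y_def transpose_def)
    moreover have "finite {u. x u \<noteq> u}"
      by (rule finite_subset[of _ "{1..N}"]) (use less.prems in \<open>auto simp: permutes_def\<close>)
    ultimately have "card {u. y u \<noteq> u} < card {u. x u \<noteq> u}"
      using a by (intro psubset_card_mono) auto
    then obtain ts where ts: "set ts \<subseteq> transpositions N" "word_prod ts = y"
      "card (invariant_sets {1..N} y) * 2 ^ length ts = 2 ^ N"
      using less.hyps y by blast
    have yt: "y \<circ> ?t = x" by (simp add: y_def comp_transpose_cancel)
    \<comment> \<open>Since \<open>a\<close> is alone in its cycle of \<open>y\<close>, returning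
      from \<open>y\<close> to \<open>x\<close> is a merge.\<close>
    have "orbit y a \<subseteq> {a}" using ya by (intro orbit_subset_closed) auto
    then have "card (invariant_sets {1..N} y) = 2 * card (invariant_sets {1..N} x)"
      using card_invariant_sets_merge[OF _ y aN, of b] ab yt by auto
    then show ?thesis
      using ts t yt by (intro exI[of _ "ts @ [?t]"]) (simp add: mult_ac)
  qed
qed

text \<open>This is the formula "length equals \<open>N\<close> minus the number of cycles" in
  exponential form.\<close>

lemma card_invariant_sets_len2:
  assumes "x permutes {1..N}"
  shows "card (invariant_sets {1..N} x) * 2 ^ len2 N x = 2 ^ N"
proof -
  obtain ts where ts: "set ts \<subseteq> transpositions N" "word_prod ts = x"
    "card (invariant_sets {1..N} x) * 2 ^ length ts = 2 ^ N"
    using exists_short_transposition_word[OF assms] by blast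
  obtain us where us: "length us = len2 N x" "set us \<subseteq> transpositions N" "word_prod us = x"
    unfolding len2_def using gen_length_word[OF ts(1,2)] .
  have "len2 N x \<le> length ts" unfolding len2_def using gen_length_le[OF ts(1,2)] .
  then have "card (invariant_sets {1..N} x) * 2 ^ len2 N x \<le> 2 ^ N"
    unfolding ts(3)[symmetric] by simp
  then show ?thesis using word_prod_transpositions_lower[OF us(2)] us by simp
qed

lemma len2_word:
  assumes "x permutes {1..N}"
  obtains ts where "length ts = len2 N x" "set ts \<subseteq> transpositions N" "word_prod ts = x"
proof -
  obtain us where "set us \<subseteq> transpositions N" "word_prod us = x"
    using exists_short_transposition_word[OF assms] by blast
  then show thesis using gen_length_word that unfolding len2_def by blast
qed

lemma len2_le: "set ts \<subseteq> transpositions N \<Longrightarrow> word_prod ts = x \<Longrightarrow> len2 N x \<le> length ts"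
  unfolding len2_def by (rule gen_length_le)

lemma len2_id: "len2 N id = 0"
  using len2_le[of "[]" N id] by simp

lemma len2_eq_0:
  assumes "x permutes {1..N}" "len2 N x = 0"
  shows "x = id"
proof -
  obtain ts where "length ts = len2 N x" "word_prod ts = x" using len2_word[OF assms(1)] .
  then show ?thesis using assms(2) by simp
qed

lemma len2_comp_le:
  assumes "x permutes {1..N}" "y permutes {1..N}"
  shows "len2 N (x \<circ> y) \<le> len2 N x + len2 N y"
proof -
  obtain ts where ts: "length ts = len2 N x" "set ts \<subseteq> transpositions N" "word_prod ts = x"
    using len2_word[OF assms(1)] .
  obtain us where us: "length us = len2 N y" "set us \<subseteq> transpositions N" "word_prod us = y"
    using len2_word[OF assms(2)] .
  show ?thesis using len2_le[of "ts @ us" N "x \<circ> y"] ts us by simp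
qed

lemma len2_conj:
  assumes "p permutes {1..N}" "q permutes {1..N}"
  shows "len2 N (inv' q \<circ> p \<circ> q) = len2 N p"
proof -
  have r: "inv' q \<circ> p \<circ> q permutes {1..N}"
    by (rule permutes_compose[OF assms(2) permutes_compose[OF assms(1) permutes_inv[OF assms(2)]]])
  have "card (invariant_sets {1..N} p) * 2 ^ len2 N (inv' q \<circ> p \<circ> q) =
      card (invariant_sets {1..N} p) * 2 ^ len2 N p"
    using card_invariant_sets_len2[OF r] card_invariant_sets_len2[OF assms(1)]
      card_invariant_sets_conj[OF assms] by simp
  moreover have "card (invariant_sets {1..N} p) \<noteq> 0"
    using card_invariant_sets_len2[OF assms(1)]
    by (metis mult_zero_left power_not_zero zero_neq_numeral)
  ultimately show ?thesis by simp
qed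

text \<open>Used in contrapositive form too: if multiplying by a transposition shortens
  \<open>p\<close>, its two points lie in one cycle of \<open>p\<close>.\<close>

lemma len2_merge:
  assumes p: "p permutes {1..N}" and ab: "a \<in> {1..N}" "b \<in> {1..N}" and b: "b \<notin> orbit p a"
  shows "len2 N (p \<circ> transpose a b) = Suc (len2 N p)"
proof -
  let ?q = "p \<circ> transpose a b"
  have q: "?q permutes {1..N}" by (rule permutes_compose[OF permutes_swap_id[OF ab] p])
  have "card (invariant_sets {1..N} ?q) * 2 ^ len2 N ?q =
      card (invariant_sets {1..N} ?q) * 2 ^ Suc (len2 N p)"
    using card_invariant_sets_len2[OF q] card_invariant_sets_len2[OF p]
      card_invariant_sets_merge[OF _ p ab(1) b] by simp
  moreover have "card (invariant_sets {1..N} ?q) \<noteq> 0"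
    using card_invariant_sets_len2[OF q] by (metis mult_zero_left power_not_zero zero_neq_numeral)
  ultimately show ?thesis by (simp del: power_Suc)
qed

section \<open>The order on permutations\<close>

lemma permutes_inv_comp: "x permutes S \<Longrightarrow> y permutes S \<Longrightarrow> inv' x \<circ> y permutes S"
  by (intro permutes_compose permutes_inv)

lemma permutes_comp_inv_comp: "x permutes S \<Longrightarrow> x \<circ> (inv' x \<circ> y) = y"
  by (simp add: comp_assoc[symmetric] permutes_inv_o)

lemma le2_refl: "x permutes {1..N} \<Longrightarrow> le2 N x x"
  by (simp add: le2_def permutes_inv_o len2_id)

lemma le2_antisym:
  assumes "x permutes {1..N}" "y permutes {1..N}" "le2 N x y" "le2 N y x"
  shows "x = y"
proof -
  have "len2 N (inv' x \<circ> y) = 0" using assms(3,4) by (simp add: le2_def)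
  then have "inv' x \<circ> y = id" using len2_eq_0 permutes_inv_comp assms(1,2) by blast
  then show ?thesis using permutes_comp_inv_comp[OF assms(1), of y] by simp
qed

lemma le2_trans:
  assumes x: "x permutes {1..N}" and y: "y permutes {1..N}" and z: "z permutes {1..N}"
    and "le2 N x y" "le2 N y z"
  shows "le2 N x z"
proof -
  have "(inv' x \<circ> y) \<circ> (inv' y \<circ> z) = inv' x \<circ> z"
    using permutes_comp_inv_comp[OF y, of z] by (simp add: comp_assoc)
  then have "len2 N (inv' x \<circ> z) \<le> len2 N (inv' x \<circ> y) + len2 N (inv' y \<circ> z)"
    using len2_comp_le[OF permutes_inv_comp[OF x y] permutes_inv_comp[OF y z]] by simp
  moreover have "len2 N z \<le> len2 N x + len2 N (inv' x \<circ> z)"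
    using len2_comp_le[OF x permutes_inv_comp[OF x z]] permutes_comp_inv_comp[OF x, of z] by simp
  ultimately show ?thesis using assms(4,5) by (simp add: le2_def)
qed

text \<open>The remaining factor from \<open>inv' x \<circ> y\<close> up to \<open>y\<close> is a
  conjugate of \<open>x\<close>, so it has the length of \<open>x\<close>.\<close>

lemma le2_complement:
  assumes x: "x permutes {1..N}" and y: "y permutes {1..N}" and "le2 N x y"
  shows "le2 N (inv' x \<circ> y) y"
proof -
  have "inv' (inv' x \<circ> y) = inv' y \<circ> x"
    using x y by (simp add: o_inv_distrib permutes_bij bij_imp_bij_inv inv_inv_eq)
  then have "len2 N (inv' (inv' x \<circ> y) \<circ> y) = len2 N x"
    using len2_conj[OF x y] by simp
  then show ?thesis using assms(3) by (simp add: le2_def)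
qed

section \<open>Increasing cycles\<close>

text \<open>A pointwise form of "each cycle can be written increasingly": \<open>x u\<close> is the
  next larger element of the cycle, or else \<open>u\<close> is its maximum and \<open>x u\<close>
  its minimum. Fixed points fall under the second case.\<close>

definition increasing_cycles :: "(nat \<Rightarrow> nat) \<Rightarrow> bool" where
  "increasing_cycles x \<longleftrightarrow> (\<forall>u. \<forall>w \<in> orbit x u.
     (u < x u \<longrightarrow> w \<le> u \<or> x u \<le> w) \<and> (x u \<le> u \<longrightarrow> x u \<le> w \<and> w \<le> u))"

lemma increasing_cyclesD:
  assumes "increasing_cycles x" "w \<in> orbit x u"
  shows "u < x u \<Longrightarrow> w \<le> u \<or> x u \<le> w" "x u \<le> u \<Longrightarrow> x u \<le> w" "x u \<le> u \<Longrightarrow> w \<le> u"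
  using assms by (auto simp: increasing_cycles_def)

section \<open>Splitting increasing cycles\<close>

lemma orbit_comp_transpose_subset:
  assumes fin: "finite S" and p: "p permutes S" and b: "b \<in> orbit p a"
  shows "orbit (p \<circ> transpose a b) u \<subseteq> orbit p u"
proof (rule orbit_subset_closed)
  have a: "a \<in> orbit p b" using orbit_sym[OF fin p b] .
  fix v assume "v \<in> orbit p u"
  moreover have "transpose a b v \<in> orbit p v"
    using a b permutes_self_in_orbit[OF fin p] by (auto simp: transpose_def)
  ultimately show "(p \<circ> transpose a b) v \<in> orbit p u"
    by (metis comp_apply orbit.step orbit_trans)
qed (rule permutes_self_in_orbit[OF fin p])

text \<open>The cycle is cut into the arc above \<open>a\<close> up to \<open>b\<close> and the
  rest. Only \<open>a\<close> and \<open>b\<close> get new successors, which they exchange: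
  \<open>b\<close> returns to the minimum \<open>p a\<close> of its arc, and \<open>a\<close> skips
  the arc to \<open>p b\<close>.\<close>

lemma increasing_cycles_split_less:
  assumes fin: "finite S" and p: "p permutes S" and inc: "increasing_cycles p"
    and b: "b \<in> orbit p a" and ab: "a < b"
  shows "increasing_cycles (p \<circ> transpose a b)"
proof -
  let ?q = "p \<circ> transpose a b"
  let ?O = "orbit p a"
  have O: "orbit p w = ?O" if "w \<in> ?O" for w
    using that by (auto intro: orbit_trans orbit_sym[OF fin p])
  \<comment> \<open>A larger element \<open>v\<close> of the cycle shows that \<open>w\<close> is
    not the maximum, so \<open>p w\<close> is the next element.\<close>
  have up: "w < p w" "p w \<le> v" if "w \<in> ?O" "v \<in> ?O" "w < v" for v w
    using increasing_cyclesD[OF inc, of v w] that O[of w] by fastforce+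
  have down: "p w \<le> v" "v \<le> w" if "w \<in> ?O" "v \<in> ?O" "p w \<le> w" for v w
    using increasing_cyclesD[OF inc, of v w] that O[of w] by auto
  have aO: "a \<in> ?O" using permutes_self_in_orbit[OF fin p] .
  have qa: "?q a = p b" and qb: "?q b = p a" by simp_all
  have q: "?q u = p u" if "u \<noteq> a" "u \<noteq> b" for u using that by (simp add: transpose_def)
  let ?B = "{w \<in> ?O. a < w \<and> w \<le> b}" and ?A = "{w \<in> ?O. w \<le> a \<or> b < w}"
  have B: "orbit ?q b \<subseteq> ?B"
  proof (rule orbit_subset_closed)
    fix w assume w: "w \<in> ?B"
    show "?q w \<in> ?B"
    proof (cases "w = b")
      case True
      then show ?thesis using up[OF aO b ab] orbit.base[of p a] qb by simp
    next
      case False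
      then have "w < b" using w by auto
      then show ?thesis using w q[of w] up[of w b] b orbit.step[of w p a] by auto
    qed
  qed (use ab b in auto)
  have A: "orbit ?q a \<subseteq> ?A"
  proof (rule orbit_subset_closed)
    fix w assume w: "w \<in> ?A"
    have "p w \<in> ?O" "p b \<in> ?O" using w b by (auto intro: orbit.step)
    consider "w < a" | "w = a" | "b < w" using w by fastforce
    then show "?q w \<in> ?A"
    proof cases
      case 1
      then show ?thesis using w \<open>p w \<in> ?O\<close> q[of w] up[of w a] aO ab by auto
    next
      case 2
      have "p b \<le> a \<or> b < p b" using down(1)[OF b aO] by linarith
      then show ?thesis using 2 \<open>p b \<in> ?O\<close> qa by simp
    next
      case 3
      then have "p w \<le> a \<or> w < p w" using down(1)[of w a] w aO by fastforce
      then show ?thesis using 3 \<open>p w \<in> ?O\<close> q[of w] ab by auto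
    qed
  qed (use aO in auto)
  show ?thesis
    unfolding increasing_cycles_def
  proof (intro allI ballI)
    fix u w assume w: "w \<in> orbit ?q u"
    consider "u = a" | "u = b" | "u \<noteq> a" "u \<noteq> b" by blast
    then show "(u < ?q u \<longrightarrow> w \<le> u \<or> ?q u \<le> w) \<and> (?q u \<le> u \<longrightarrow> ?q u \<le> w \<and> w \<le> u)"
    proof cases
      case 1
      then have "w \<in> ?A" using w A by blast
      then show ?thesis
        unfolding 1 qa using up[OF b, of w] down[OF b, of w] down[OF b, of a] aO ab by fastforce
    next
      case 2
      then have "w \<in> ?B" using w B by blast
      then show ?thesis
        unfolding 2 qb using up[OF aO, of w] up[OF aO b ab] by fastforce
    next
      \<comment> \<open>Here the successor is unchanged and the orbit can only shrink.\<close>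
      case 3
      then show ?thesis
        using q[OF 3] increasing_cyclesD[OF inc, of w u] orbit_comp_transpose_subset[OF fin p b] w
        by auto
    qed
  qed
qed

lemma increasing_cycles_split:
  assumes fin: "finite S" and p: "p permutes S" and inc: "increasing_cycles p"
    and b: "b \<in> orbit p a"
  shows "increasing_cycles (p \<circ> transpose a b)"
proof -
  consider "a < b" | "a = b" | "b < a" by linarith
  then show ?thesis
  proof cases
    case 1
    then show ?thesis using increasing_cycles_split_less[OF assms] by simp
  next
    case 2
    then show ?thesis using inc by simp
  next
    case 3
    then show ?thesis
      using increasing_cycles_split_less[OF fin p inc orbit_sym[OF fin p b]]
      by (simp add: transpose_commute)
  qed
qed

text \<open>Induction on the length gap. The first letter \<open>t\<close> of a shortest word for
  \<open>inv' z \<circ> y\<close> gives \<open>w = z \<circ> t\<close>, one step closer to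
  \<open>y\<close>, and \<open>z\<close> arises from \<open>w\<close> by splitting a cycle.\<close>

lemma le2_refines:
  assumes "z permutes {1..N}" "y permutes {1..N}" "le2 N z y" "increasing_cycles y"
  shows "increasing_cycles z \<and> (\<forall>u. orbit z u \<subseteq> orbit y u)"
  using assms(1,3)
proof (induct "len2 N y - len2 N z" arbitrary: z)
  case 0
  have "len2 N (inv' z \<circ> y) = 0" using 0 by (simp add: le2_def)
  then have "inv' z \<circ> y = id" using len2_eq_0 permutes_inv_comp 0(2) assms(2) by blast
  then have "z = y" using permutes_comp_inv_comp[OF 0(2), of y] by simp
  then show ?case using assms(4) by simp
next
  case (Suc d)
  note z = Suc.prems(1)
  have lz: "len2 N (inv' z \<circ> y) = Suc d" "len2 N y = len2 N z + Suc d"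
    using Suc.hyps(2) Suc.prems(2) by (auto simp: le2_def)
  obtain ts where ts: "length ts = Suc d" "set ts \<subseteq> transpositions N"
    "word_prod ts = inv' z \<circ> y"
    using len2_word[OF permutes_inv_comp[OF z assms(2)]] lz(1) by metis
  then obtain t us where tus: "ts = t # us" by (cases ts) auto
  define r where "r = word_prod us"
  have tr: "t \<circ> r = inv' z \<circ> y" using ts(3) by (simp add: tus r_def)
  have lr: "len2 N r \<le> d"
    using len2_le[of us N r] ts by (simp add: tus r_def)
  obtain a b where t: "t = transpose a b" "a \<in> {1..N}" "b \<in> {1..N}" "a \<noteq> b"
    using ts(2) tus by (auto simp: transpositions_def)
  have tN: "t \<in> transpositions N" using ts(2) tus by simp
  define w where "w = z \<circ> t"
  have w: "w permutes {1..N}"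
    unfolding w_def using z transposition_permutes[OF tN] by (intro permutes_compose)
  have r: "r permutes {1..N}"
    unfolding r_def using ts(2) tus by (intro word_prod_transpositions_permutes) simp
  have wt: "w \<circ> transpose a b = z" by (simp add: w_def t(1) comp_transpose_cancel)
  have wr: "w \<circ> r = y"
    using permutes_comp_inv_comp[OF z, of y] tr by (simp add: w_def comp_assoc)
  then have ir: "inv' w \<circ> y = r"
    using permutes_inv_o(2)[OF w] by (simp add: comp_assoc[symmetric] flip: wr)
  have "len2 N t \<le> 1" using len2_le[of "[t]" N t] tN by simp
  then have "len2 N w \<le> Suc (len2 N z)"
    unfolding w_def using len2_comp_le[OF z transposition_permutes[OF tN]] by simp
  moreover have "len2 N y \<le> len2 N w + len2 N r" using len2_comp_le[OF w r] wr by simp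
  \<comment> \<open>The two triangle inequalities and \<open>len2 N r \<le> d\<close> leave no
    slack, so all are equalities.\<close>
  ultimately have lw: "len2 N w = Suc (len2 N z)" "le2 N w y"
    using lr lz(2) by (auto simp: le2_def ir)
  have IH: "increasing_cycles w \<and> (\<forall>u. orbit w u \<subseteq> orbit y u)"
    using Suc.hyps(1)[OF _ w lw(2)] lw(1) lz(2) by simp
  \<comment> \<open>Otherwise \<open>z = w \<circ> t\<close> would be longer than
    \<open>w\<close>.\<close>
  have ba: "b \<in> orbit w a"
    using len2_merge[OF w t(2,3)] wt lw(1) by fastforce
  show ?case
    using increasing_cycles_split[OF _ w _ ba] orbit_comp_transpose_subset[OF _ w ba] IH wt
    by fastforce
qed

section \<open>The long cycle and noncrossing partitions\<close>

lemma long_cycle_permutes: "long_cycle N permutes {1..N}"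
  using cycle_permutes[of "[1..<Suc N]"]
  by (simp add: long_cycle_def atLeastLessThanSuc_atLeastAtMost del: upt_Suc)

lemma long_cycle_apply:
  assumes "1 \<le> u" "u \<le> N"
  shows "long_cycle N u = (if u = N then 1 else Suc u)"
proof -
  let ?cs = "[1..<Suc N]"
  have "map (cycle_of_list ?cs) ?cs = rotate1 ?cs"
    using cyclic_rotation[of ?cs 1] by simp
  \<comment> \<open>The list starts with 1 at index 0, so \<open>u\<close> stands at index
    \<open>u - 1\<close>.\<close>
  then have "map (cycle_of_list ?cs) ?cs ! (u - 1) = rotate1 ?cs ! (u - 1)" by simp
  then show ?thesis
    using assms by (auto simp: nth_rotate1 long_cycle_def nth_append simp del: upt_Suc)
qed

lemma increasing_cycles_long_cycle: "increasing_cycles (long_cycle N)"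
  unfolding increasing_cycles_def
proof (intro allI ballI)
  fix u w assume w: "w \<in> orbit (long_cycle N) u"
  show "(u < long_cycle N u \<longrightarrow> w \<le> u \<or> long_cycle N u \<le> w) \<and>
    (long_cycle N u \<le> u \<longrightarrow> long_cycle N u \<le> w \<and> w \<le> u)"
  proof (cases "u \<in> {1..N}")
    case True
    then have "w \<in> {1..N}" using w permutes_orbit_subset[OF long_cycle_permutes] by blast
    then show ?thesis using True long_cycle_apply[of u N] by auto
  next
    case False
    then have u: "long_cycle N u = u" using long_cycle_permutes by (meson permutes_not_in)
    then have "orbit (long_cycle N) u \<subseteq> {u}" by (intro orbit_subset_closed) auto
    then show ?thesis using u w by auto
  qed
qed

lemma NC_permutes: "x \<in> NC N \<Longrightarrow> x permutes {1..N}"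
  by (simp add: NC_def sym_group_carrier)

lemma NC_increasing_cycles: "x \<in> NC N \<Longrightarrow> increasing_cycles x"
  using le2_refines[OF _ long_cycle_permutes _ increasing_cycles_long_cycle, of x N]
  by (simp add: NC_def sym_group_carrier)

section \<open>Alternating parity\<close>

text \<open>Both requirements of \<open>ONC\<close> in one: ascents have odd gaps, and the return
  from maximum to minimum keeps parity, which for odd gaps means odd length.\<close>

definition alternating_cycles :: "nat \<Rightarrow> (nat \<Rightarrow> nat) \<Rightarrow> bool" where
  "alternating_cycles N x \<longleftrightarrow> x permutes {1..N} \<and> increasing_cycles x \<and>
     (\<forall>u. u < x u \<longleftrightarrow> even u \<noteq> even (x u))"

text \<open>Links the pointwise description to the lists in \<open>ONC\<close>: the entry at index
  \<open>j\<close> goes to the next one, since nothing in the orbit lies between, and the last entry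
  goes to the minimum at index 0.\<close>

lemma increasing_cycle_of_orbit:
  assumes x: "x permutes {1..N}" and inc: "increasing_cycles x" and u: "u \<in> {1..N}"
  shows "increasing_cycle_of N x (sorted_list_of_set (orbit x u))"
proof -
  let ?O = "orbit x u"
  define us where "us = sorted_list_of_set ?O"
  have uO: "u \<in> ?O" using permutes_self_in_orbit[OF _ x] by simp
  have fin: "finite ?O" using finite_orbit[OF uO] .
  have set: "set us = ?O" and srt: "sorted_wrt (<) us"
    using fin by (simp_all add: us_def)
  have ne: "us \<noteq> []" using set uO by auto
  have lt: "us ! i < us ! j" if "i < j" "j < length us" for i j
    using sorted_wrt_nth_less[OF srt] that by blast
  have "map x us = rotate1 us"
  proof (rule nth_equalityI)
    fix j assume "j < length (map x us)"
    then have j: "j < length us" by simp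
    have jO: "us ! j \<in> ?O" using j set nth_mem by blast
    then have "x (us ! j) \<in> ?O" by (rule orbit.step)
    then obtain k where k: "k < length us" "x (us ! j) = us ! k"
      using set by (metis in_set_conv_nth)
    have O: "us ! i \<in> orbit x (us ! j)" if "i < length us" for i
    proof -
      have "us ! i \<in> orbit x u" using that set nth_mem by blast
      then show ?thesis by (rule orbit_trans) (use orbit_sym[OF _ x jO] in simp)
    qed
    note D = increasing_cyclesD[OF inc O]
    have "k = Suc j mod length us"
    proof (cases "Suc j < length us")
      case True
      have 1: "us ! j < x (us ! j)"
        using D(3)[OF True] lt[of j "Suc j"] True by fastforce
      then have "j < k" using k lt[of k j] j by (metis not_less_iff_gr_or_eq)
      moreover have "\<not> Suc j < k"
        using D(1)[OF True 1] lt[of j "Suc j"] lt[of "Suc j" k] k True by fastforce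
      ultimately show ?thesis using True by simp
    next
      case False
      then have "k \<le> j" using k by linarith
      then have 1: "x (us ! j) \<le> us ! j" using k lt[of k j] j by (cases "k = j") auto
      have "k = 0" using D(2)[OF _ 1, of 0] lt[of 0 k] k by fastforce
      moreover have "length us = Suc j" using False j by simp
      ultimately show ?thesis by simp
    qed
    then show "map x us ! j = rotate1 us ! j" using j k by (simp add: nth_rotate1)
  qed simp
  moreover have "set us \<subseteq> {1..N}" using set permutes_orbit_subset[OF x u] by simp
  ultimately show ?thesis
    using ne srt unfolding increasing_cycle_of_def us_def by blast
qed

lemma ONC_alternating_cycles:
  assumes "x \<in> ONC N"
  shows "alternating_cycles N x"
proof -
  have NC: "x \<in> NC N" and cyc: "\<And>us. increasing_cycle_of N x us \<Longrightarrow>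
     odd (length us) \<and> (\<forall>j < length us - 1. odd (us ! Suc j - us ! j))"
    using assms by (auto simp: ONC_def)
  note x = NC_permutes[OF NC] and inc = NC_increasing_cycles[OF NC]
  have "u < x u \<longleftrightarrow> even u \<noteq> even (x u)" for u
  proof (cases "u \<in> {1..N}")
    case False
    then have "x u = u" using x by (meson permutes_not_in)
    then show ?thesis by simp
  next
    case True
    define us where "us = sorted_list_of_set (orbit x u)"
    have ic: "increasing_cycle_of N x us"
      using increasing_cycle_of_orbit[OF x inc True] by (simp add: us_def)
    then have odd: "odd (length us)"
      and gap: "\<And>j. Suc j < length us \<Longrightarrow> odd (us ! Suc j - us ! j)"
      using cyc[of us] by auto
    have rot: "map x us = rotate1 us" and srt: "sorted_wrt (<) us"
      using ic by (auto simp: increasing_cycle_of_def)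
    have lt: "us ! i < us ! j" if "i < j" "j < length us" for i j
      using sorted_wrt_nth_less[OF srt] that by blast
    have "u \<in> set us"
      using finite_orbit[of u x] permutes_self_in_orbit[OF _ x, of u] by (simp add: us_def)
    then obtain j where j: "j < length us" "us ! j = u" by (metis in_set_conv_nth)
    have xu: "x u = us ! (Suc j mod length us)"
      using arg_cong[OF rot, of "\<lambda>l. l ! j"] j by (simp add: nth_rotate1)
    show ?thesis
    proof (cases "Suc j < length us")
      case True
      then have "x u = us ! Suc j" using xu by simp
      then show ?thesis using lt[of j "Suc j"] gap[of j] True j by auto
    next
      case False
      then have jl: "length us = Suc j" using j by simp
      \<comment> \<open>Odd gaps make parities alternate along the list. The last index
        \<open>j\<close> is even because the length is odd, so the first and last entries agree in
        parity.\<close>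
      have par: "even (us ! i) \<longleftrightarrow> (even (us ! 0) \<longleftrightarrow> even i)" if "i < length us" for i
        using that
      proof (induct i)
        case (Suc i)
        then show ?case using gap[of i] lt[of i "Suc i"] by auto
      qed simp
      have "x u = us ! 0" using xu jl by simp
      then show ?thesis using par[of j] lt[of 0 j] jl odd j by (cases "j = 0") auto
    qed
  qed
  then show ?thesis using x inc by (simp add: alternating_cycles_def)
qed

text \<open>With \<open>v = (inv' x \<circ> y) u\<close> one has \<open>x v = y u\<close>, and
  \<open>v\<close> lies in the \<open>y\<close>-cycle of \<open>u\<close>. Increasing cycles
  restrict the position of \<open>v\<close>, and the parity rules at \<open>u\<close> and
  \<open>v\<close> meet in the common image.\<close>

lemma alternating_cycles_complement:
  assumes X: "alternating_cycles N x" and Y: "alternating_cycles N y" and le: "le2 N x y"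
  shows "alternating_cycles N (inv' x \<circ> y)"
proof -
  have x: "x permutes {1..N}" and y: "y permutes {1..N}" and incy: "increasing_cycles y"
    and px: "\<And>u. u < x u \<longleftrightarrow> even u \<noteq> even (x u)" and py: "\<And>u. u < y u \<longleftrightarrow> even u \<noteq> even (y u)"
    using X Y by (auto simp: alternating_cycles_def)
  let ?z = "inv' x \<circ> y"
  have z: "?z permutes {1..N}" using permutes_inv_comp[OF x y] .
  have ref: "increasing_cycles ?z" "\<And>u. orbit ?z u \<subseteq> orbit y u"
    using le2_refines[OF z y le2_complement[OF x y le] incy] by auto
  have "u < ?z u \<longleftrightarrow> even u \<noteq> even (?z u)" for u
  proof -
    define v where "v = ?z u"
    have xv: "x v = y u" using permutes_inverses[OF x] by (simp add: v_def)
    have "v \<in> orbit y u" using ref(2) orbit.base[of ?z u] by (auto simp: v_def)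
    note D = increasing_cyclesD[OF incy this]
    have "u < v \<longleftrightarrow> even u \<noteq> even v"
    proof (cases "u < y u")
      case True
      then show ?thesis using D(1) px[of v] py[of u] xv by auto
    next
      \<comment> \<open>Now \<open>v\<close> lies between \<open>y u\<close> and \<open>u\<close>,
        and all three have the same parity.\<close>
      case False
      then show ?thesis using D(2,3) px[of v] py[of u] xv by auto
    qed
    then show ?thesis by (simp add: v_def)
  qed
  then show ?thesis using z ref(1) by (simp add: alternating_cycles_def)
qed

lemma three_cycle_in_three_cycles:
  assumes "{a, b, c} \<subseteq> {1..N}" "a \<noteq> b" "b \<noteq> c" "a \<noteq> c"
  shows "transpose a b \<circ> transpose b c \<in> three_cycles N"
  using assms
  by (intro CollectI exI[of _ "[a, b, c]"]) auto

text \<open>Splitting off the two successors \<open>b = x a\<close> and \<open>c = x b\<close> of the smallest moved point \<open>a\<close>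
  preserves alternation because \<open>a\<close> and \<open>c\<close> have the same parity.\<close>

lemma alternating_cycles_three_cycle_word:
  assumes "alternating_cycles N x"
  shows "\<exists>ts. set ts \<subseteq> three_cycles N \<and> word_prod ts = x \<and> 2 * length ts = len2 N x"
  using assms
proof (induct "len2 N x" arbitrary: x rule: less_induct)
  case less
  have x: "x permutes {1..N}" and inc: "increasing_cycles x"
    and px: "\<And>u. u < x u \<longleftrightarrow> even u \<noteq> even (x u)"
    using less.prems by (auto simp: alternating_cycles_def)
  show ?case
  proof (cases "x = id")
    case True
    then show ?thesis by (intro exI[of _ "[]"]) (simp add: len2_id)
  next
    case False
    define a where "a = (LEAST u. x u \<noteq> u)"
    have ex: "\<exists>u. x u \<noteq> u" using False by (auto simp: fun_eq_iff)
    have a: "x a \<noteq> a" unfolding a_def using ex by (rule LeastI_ex)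
    have least: "a \<le> u" if "x u \<noteq> u" for u unfolding a_def using that by (rule Least_le)
    have inj: "x u = x v \<longleftrightarrow> u = v" for u v using permutes_inj[OF x] by (simp add: inj_eq)
    define b where "b = x a"
    define c where "c = x b"
    have xb: "x b \<noteq> b" using a inj by (simp add: b_def)
    have xc: "x c \<noteq> c" using xb inj by (simp add: c_def)
    have ab: "a < b" using least[OF xb] a by (simp add: b_def)
    have aO: "a \<in> orbit x v" if "v \<in> orbit x a" for v using orbit_sym[OF _ x that] by simp
    have bO: "b \<in> orbit x a" and cO: "c \<in> orbit x a"
      unfolding b_def c_def by (auto intro: orbit.intros)
    \<comment> \<open>A 2-cycle is impossible: going from \<open>a\<close> up to \<open>b\<close>
      flips parity, while the return from \<open>b\<close> to \<open>a\<close> would keep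
      it.\<close>
    have bc: "b < c"
    proof (rule ccontr)
      assume "\<not> b < c"
      then have "x b \<le> b" by (simp add: c_def)
      then have "c = a"
        using increasing_cyclesD(2)[OF inc aO[OF bO]] least[OF xc] by (simp add: c_def)
      then show False using px[of a] px[of b] ab by (auto simp: b_def c_def)
    qed
    have N: "a \<in> {1..N}" "b \<in> {1..N}" "c \<in> {1..N}"
      using a xb xc x by (meson permutes_not_in)+
    define x1 where "x1 = x \<circ> transpose a b"
    define y where "y = x1 \<circ> transpose a c"
    have x1: "x1 permutes {1..N}"
      unfolding x1_def using x N by (intro permutes_compose permutes_swap_id)
    have y: "y permutes {1..N}"
      unfolding y_def using x1 N by (intro permutes_compose permutes_swap_id)
    have x1v: "x1 a = c" "x1 b = b" using ab by (simp_all add: x1_def b_def c_def)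
    have yv: "y a = x c" "y b = b" "y c = c" "\<And>u. u \<notin> {a, b, c} \<Longrightarrow> y u = x u"
      using ab bc x1v by (auto simp: y_def x1_def transpose_def b_def c_def)
    have cO1: "c \<in> orbit x1 a" using orbit.base[of x1 a] x1v by simp
    have incy: "increasing_cycles y"
      unfolding y_def using increasing_cycles_split[OF _ x1 _ cO1]
        increasing_cycles_split[OF _ x inc bO] by (simp add: x1_def)
    have "u < y u \<longleftrightarrow> even u \<noteq> even (y u)" for u
    proof (cases "u = a")
      case True
      \<comment> \<open>The new successor of \<open>a\<close> is \<open>x c\<close>. It lies either
        above \<open>c\<close>, hence above \<open>a\<close>, or at most at \<open>a\<close>, so
        comparing it with \<open>a\<close> gives the same answer as comparing it with
        \<open>c\<close>.\<close>
      have "x c \<le> c \<longrightarrow> x c \<le> a" using increasing_cyclesD(2)[OF inc aO[OF cO]] by blast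
      then show ?thesis
        using px[of a] px[of b] px[of c] ab bc True yv(1) by (auto simp: b_def c_def)
    next
      case False
      then show ?thesis using yv px[of u] by (cases "u \<in> {a, b, c}") auto
    qed
    then have Y: "alternating_cycles N y" using y incy by (simp add: alternating_cycles_def)
    have yx1: "y \<circ> transpose a c = x1" and x1x: "x1 \<circ> transpose a b = x"
      by (simp_all add: y_def x1_def comp_transpose_cancel)
    \<comment> \<open>From \<open>y\<close> back to \<open>x\<close>, first \<open>c\<close> and
      then \<open>b\<close> joins the cycle of \<open>a\<close>, and each merge adds one to the
      length.\<close>
    have "orbit y c \<subseteq> {c}" "orbit x1 b \<subseteq> {b}"
      by (rule orbit_subset_closed; use yv(3) x1v(2) in simp)+
    then have "a \<notin> orbit y c" "a \<notin> orbit x1 b" using ab bc by auto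
    then have len: "len2 N x = Suc (Suc (len2 N y))"
      using len2_merge[OF y N(3,1)] len2_merge[OF x1 N(2,1)] yx1 x1x
      by (simp add: transpose_commute)
    then obtain ts where ts: "set ts \<subseteq> three_cycles N" "word_prod ts = y"
      "2 * length ts = len2 N y" using less.hyps[OF _ Y] by auto
    define s where "s = transpose c a \<circ> transpose a b"
    have "s \<in> three_cycles N"
      unfolding s_def using N ab bc by (intro three_cycle_in_three_cycles) auto
    moreover have "y \<circ> s = x"
      unfolding s_def using yx1 x1x by (simp add: comp_assoc[symmetric] transpose_commute)
    ultimately show ?thesis
      using ts len by (intro exI[of _ "ts @ [s]"]) simp
  qed
qed

section \<open>3-cycle length against transposition length\<close>

lemma three_cycle_word_transpositions:
  "set ts \<subseteq> three_cycles N \<Longrightarrow> \<exists>us. set us \<subseteq> transpositions N \<and>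
    word_prod us = word_prod ts \<and> length us = 2 * length ts"
proof (induct ts)
  case Nil
  then show ?case by (intro exI[of _ "[]"]) simp
next
  case (Cons t ts)
  then obtain us where us: "set us \<subseteq> transpositions N"
    "word_prod us = word_prod ts" "length us = 2 * length ts" by auto
  obtain cs where cs: "t = cycle_of_list cs" "distinct cs" "length cs = 3" "set cs \<subseteq> {1..N}"
    using Cons.prems by auto
  then obtain a b c where abc: "cs = [a, b, c]"
    by (auto simp: length_Suc_conv numeral_3_eq_3)
  have "transpose a b \<in> transpositions N" "transpose b c \<in> transpositions N"
    using cs abc by (auto simp: transpositions_def)
  then show ?case
    using us cs abc
    by (intro exI[of _ "transpose a b # transpose b c # us"]) (simp add: comp_assoc)
qed

text \<open>The word from the stripping argument bounds \<open>len3\<close> above; replacing each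
  3-cycle by two transpositions bounds it below.\<close>

lemma len3_alternating_cycles:
  assumes "alternating_cycles N x"
  shows "2 * len3 N x = len2 N x"
proof -
  obtain ts where ts: "set ts \<subseteq> three_cycles N" "word_prod ts = x" "2 * length ts = len2 N x"
    using alternating_cycles_three_cycle_word[OF assms] by blast
  have "len3 N x \<le> length ts" unfolding len3_def using gen_length_le[OF ts(1,2)] .
  moreover obtain us where "length us = len3 N x" "set us \<subseteq> three_cycles N" "word_prod us = x"
    unfolding len3_def using gen_length_word[OF ts(1,2)] .
  then have "len2 N x \<le> 2 * len3 N x"
    using three_cycle_word_transpositions[of us N] len2_le by metis
  ultimately show ?thesis using ts(3) by simp
qed

lemma word_prod_three_cycles_alt_group:
  "set ts \<subseteq> three_cycles N \<Longrightarrow> word_prod ts \<in> carrier (alt_group N)"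
proof (induct ts)
  case Nil
  show "word_prod [] \<in> carrier (alt_group N)"
    by (simp add: alt_group_carrier permutes_id evenperm_id)
next
  case (Cons t ts)
  interpret A: group "alt_group N" by (rule alt_group_is_group)
  have "t \<in> carrier (alt_group N)" using Cons.prems three_cycles_incl[of N] by auto
  moreover have "word_prod ts \<in> carrier (alt_group N)" using Cons by simp
  ultimately have "t \<otimes>\<^bsub>alt_group N\<^esub> word_prod ts \<in> carrier (alt_group N)" by simp
  then show "word_prod (t # ts) \<in> carrier (alt_group N)" by (simp add: alt_group_mult)
qed

text \<open>Needed so that \<open>inv' x \<circ> y\<close> has a 3-cycle word and its
  \<open>len3\<close> is a genuine minimum.\<close>

lemma three_cycle_word_inv:
  "set ts \<subseteq> three_cycles N \<Longrightarrow>
    \<exists>us. set us \<subseteq> three_cycles N \<and> word_prod us \<circ> word_prod ts = id"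
proof (induct ts)
  case Nil
  then show ?case by (intro exI[of _ "[]"]) simp
next
  case (Cons t ts)
  obtain us where us: "set us \<subseteq> three_cycles N"
    "word_prod us \<circ> word_prod ts = id" using Cons by (meson set_subset_Cons subset_trans)
  obtain cs where cs: "t = cycle_of_list cs" "distinct cs" "length cs = 3" "set cs \<subseteq> {1..N}"
    using Cons.prems by auto
  then obtain a b c where abc: "cs = [a, b, c]"
    by (auto simp: length_Suc_conv numeral_3_eq_3)
  define s where "s = transpose c b \<circ> transpose b a"
  have s: "s \<in> three_cycles N"
    unfolding s_def using cs abc by (intro three_cycle_in_three_cycles) auto
  have st: "s \<circ> t = id"
    unfolding s_def cs(1) abc by (simp add: fun_eq_iff transpose_commute)
  have "word_prod (us @ [s]) \<circ> word_prod (t # ts)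
      = word_prod us \<circ> (s \<circ> t) \<circ> word_prod ts"
    by (simp add: comp_assoc)
  then have "word_prod (us @ [s]) \<circ> word_prod (t # ts) = id" using us(2) st by simp
  moreover have "set (us @ [s]) \<subseteq> three_cycles N" using us(1) s by simp
  ultimately show ?case by blast
qed

text \<open>From \<open>le2\<close>, the complement is alternating and all three lengths halve. From
  \<open>le3\<close>, only \<open>len2 \<le> 2 * len3\<close> is used for the complement, and the
  triangle inequality turns it into equality.\<close>

lemma le3_iff_le2:
  assumes X: "alternating_cycles N x" and Y: "alternating_cycles N y"
  shows "le3 N x y \<longleftrightarrow> le2 N x y"
proof
  let ?z = "inv' x \<circ> y"
  have x: "x permutes {1..N}" and y: "y permutes {1..N}"
    using X Y by (auto simp: alternating_cycles_def)
  note lens = len3_alternating_cycles[OF X] len3_alternating_cycles[OF Y]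
  show "le3 N x y" if "le2 N x y"
    using len3_alternating_cycles[OF alternating_cycles_complement[OF X Y that]] lens that
    by (simp add: le2_def le3_def)
  assume le: "le3 N x y"
  obtain ts where ts: "set ts \<subseteq> three_cycles N" "word_prod ts = x"
    using alternating_cycles_three_cycle_word[OF X] by blast
  obtain us where us: "set us \<subseteq> three_cycles N" "word_prod us = y"
    using alternating_cycles_three_cycle_word[OF Y] by blast
  obtain vs where vs: "set vs \<subseteq> three_cycles N" "word_prod vs \<circ> x = id"
    using three_cycle_word_inv[OF ts(1)] ts(2) by blast
  have "word_prod vs = word_prod vs \<circ> (x \<circ> inv' x)"
    using permutes_inv_o(1)[OF x] by simp
  also have "\<dots> = inv' x" using vs(2) by (simp add: comp_assoc[symmetric])
  finally have w: "set (vs @ us) \<subseteq> three_cycles N" "word_prod (vs @ us) = ?z"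
    using vs us by simp_all
  obtain ws where "length ws = len3 N ?z" "set ws \<subseteq> three_cycles N" "word_prod ws = ?z"
    unfolding len3_def using gen_length_word[OF w] .
  then have "len2 N ?z \<le> 2 * len3 N ?z"
    using three_cycle_word_transpositions[of ws N] len2_le by metis
  moreover have "len2 N y \<le> len2 N x + len2 N ?z"
    using len2_comp_le[OF x permutes_inv_comp[OF x y]] permutes_comp_inv_comp[OF x, of y] by simp
  ultimately show "le2 N x y" using le lens by (simp add: le2_def le3_def)
qed

section \<open>The induced subposet\<close>

lemma NC_partial_order: "partial_order_on (NC N) (rel_on (NC N) (le2 N))"
  unfolding partial_order_on_def preorder_on_def
proof (intro conjI)
  show "refl_on (NC N) (rel_on (NC N) (le2 N))"
    using le2_refl NC_permutes by (auto simp: refl_on_def rel_on_def)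
  show "trans (rel_on (NC N) (le2 N))"
    using le2_trans NC_permutes unfolding trans_def rel_on_def by blast
  show "antisym (rel_on (NC N) (le2 N))"
    using le2_antisym NC_permutes unfolding antisym_def rel_on_def by blast
qed (auto simp: rel_on_def)

theorem theorem4p9:
  fixes N :: nat
  assumes "N \<ge> 3"
  shows "ONC N \<subseteq> carrier (alt_group N) \<and>
    (\<forall>x \<in> ONC N. \<forall>y \<in> ONC N. le3 N x y \<longleftrightarrow> le2 N x y) \<and>
    induced_subposet (ONC N) (le3 N) (NC N) (le2 N)"
proof (intro conjI)
  show "ONC N \<subseteq> carrier (alt_group N)"
  proof
    fix x assume "x \<in> ONC N"
    then obtain ts where "set ts \<subseteq> three_cycles N" "word_prod ts = x"
      using alternating_cycles_three_cycle_word[OF ONC_alternating_cycles] by blast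
    then show "x \<in> carrier (alt_group N)" using word_prod_three_cycles_alt_group by blast
  qed
  show iff: "\<forall>x \<in> ONC N. \<forall>y \<in> ONC N. le3 N x y \<longleftrightarrow> le2 N x y"
    using le3_iff_le2 ONC_alternating_cycles by blast
  have sub: "ONC N \<subseteq> NC N" by (auto simp: ONC_def)
  have eq: "rel_on (ONC N) (le3 N) = rel_on (NC N) (le2 N) \<inter> (ONC N \<times> ONC N)"
    using iff sub by (auto simp: rel_on_def)
  \<comment> \<open>By \<open>eq\<close> the order axioms for \<open>le3\<close> are inherited from
    \<open>NC N\<close>.\<close>
  have "partial_order_on (ONC N) (rel_on (ONC N) (le3 N))"
    using NC_partial_order[of N] sub unfolding eq
    by (auto simp: partial_order_on_def preorder_on_def refl_on_def trans_def antisym_def)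
  then show "induced_subposet (ONC N) (le3 N) (NC N) (le2 N)"
    using NC_partial_order sub eq by (simp add: induced_subposet_def)
qed

end
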